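(* Let $f_n\colon X\to X$, $n\in\mathbb{N}$, be a sequence of maps such that $A_n+f_n$ is a homeomorphism of $X$ for each $n\in\mathbb{N}$ and $$\|P^k_n f_{n-1}\|_\infty\le \nu^k_n\quad\text{for every } k\in K^s\cup K^u \text{ and } n\ge 1 .$$ Moreover, assume that for each $k\in K^s\cup K^u$, $x,y\in X$ and $n\ge 1$, $$|P^k_nf_{n-1}(x)-P^k_nf_{n-1}(y)|\le \mu^k_n|x-y| .$$ Suppose that $$\sum_{k\in K^s\cup K^u}\lambda_k<1 .$$ Then: (i) There exist sequences of continuous maps $H_n\colon X\to X$, $n\in\mathbb{N}$, and $\tau_n\colon X\to\bigoplus_{k\in K^c}X_k(n+1)$, $n\in\mathbb{N}$, such that $$H_{n+1}\circ A_n=(A_n+f_n)\circ H_n+\tau_n\circ H_n\quad\text{for every } n\in\mathbb{N}.$$ In addition, $\sup_{n\in\mathbb{N}}\|H_n-\mathrm{Id}\|_\infty<+\infty$ and $\tau_n(x)=-\sum_{k\in K^c}P^k_{n+1}(f_n(x))$ for all $x\in X$, $n\in\mathbb{N}$. (ii) There exist sequences of continuous maps $\bar H_n\colon X\to X$, $n\in\mathbb{N}$, and $\bar\tau_n\colon X\to\bigoplus_{k\in K^c}X_k(n+1)$, $n\in\mathbb{N}$, such that $$\bar H_{n+1}\circ(A_n+f_n)=A_n\circ\bar H_n+\bar\tau_n\quad\text{for every } n\in\mathbb{N}.$$ In addition, $\sup_{n\in\mathbb{N}}\|\bar H_n-\mathrm{Id}\|_\infty<+\infty$ and $\bar\tau_n(x)=-\tau_n(x)=\sum_{k\in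 K^c}P^k_{n+1}(f_n(x))$ for all $x\in X$, $n\in\mathbb{N}$. Moreover, in the case when either $K^c=\emptyset$ or $P^k_nf_{n-1}\equiv 0$ for every $k\in K^c$ and $n\ge 1$, the maps $H_n$ and $\bar H_n$ are homeomorphisms for each $n\in\mathbb{N}$, and in addition $$H_n\circ\bar H_n=\bar H_n\circ H_n=\mathrm{Id}\quad\text{and}\quad H_{n+1}\circ A_n=(A_n+f_n)\circ H_n$$ for every $n\in\mathbb{N}$.
   Context: Here $\mathbb{N}=\{0,1,2,\dots\}$. $X=(X,|\cdot|)$ is an arbitrary Banach space, $\mathcal{B}(X)$ is the space of bounded linear operators on $X$, and $\|\cdot\|$ is the operator norm on $\mathcal{B}(X)$. For a map $g\colon X\to X$, $\|g\|_\infty:=\sup\{|g(x)|:x\in X\}$; in particular $\|P^k_nf_{n-1}\|_\infty=\sup\{|P^k_nf_{n-1}(x)|:x\in X\}$. Empty sums are $0$. $(A_n)_{n\in\mathbb{N}}$ is a sequence of invertible operators in $\mathcal{B}(X)$, with associated linear cocycle, for $m,n\in\mathbb{N}$, $$\mathcal{A}(m,n)=\begin{cases}A_{m-1}\cdots A_n & \text{if } m>n,\\ \mathrm{Id} & \text{if } m=n,\\ A_m^{-1}\cdots A_{n-1}^{-1} & \text{if } m<n.\end{cases}$$ $K$ is a finite set of the form $K=K^s\cup K^u\cup K^c$ with $K^s,K^u,K^c$ pairwise disjoint. For each $n\in\mathbb{N}$ there is a family of (bounded linear) projections $P^k_n$, $k\in K$, on $X$ such that $\sum_{k\in K}P^k_n=\mathrm{Id}$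 and $P^k_nP^l_n=0$ for all $k,l\in K$, $k\ne l$. Put $X_k(n)=P^k_n(X)$, so that $X=\bigoplus_{k\in K}X_k(n)$ for every $n\in\mathbb{N}$. (No relation between $A_nP^k_n$ and $P^k_{n+1}A_n$ is assumed.) For each $k\in K^s\cup K^u$ there are given a number $\lambda_k>0$ and sequences $(\mu^k_n)_{n\in\mathbb{N}}$ and $(\nu^k_n)_{n\in\mathbb{N}}$ of positive numbers such that: - for $k\in K^s$, $$\sup_n\sum_{l=1}^n\|\mathcal{A}(n,l)P^k_l\|\nu^k_l<+\infty\quad\text{and}\quad \sup_n\sum_{l=1}^n\|\mathcal{A}(n,l)P^k_l\|\mu^k_l\le\lambda_k;$$ - for $k\in K^u$, $$\sup_n\sum_{l=n+1}^\infty\|\mathcal{A}(n,l)P^k_l\|\nu^k_l<+\infty\quad\text{and}\quad \sup_n\sum_{l=n+1}^\infty\|\mathcal{A}(n,l)P^k_l\|\mu^k_l\le\lambda_k .$$ All suprema are over $n\in\mathbb{N}$. *)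

theory Defs
  imports "HOL-Analysis.Analysis"
begin

definition blinfun_invertible :: "('a::real_normed_vector \<Rightarrow>\<^sub>L 'a) \<Rightarrow> bool" where
  "blinfun_invertible T \<longleftrightarrow> (\<exists>S. T o\<^sub>L S = id_blinfun \<and> S o\<^sub>L T = id_blinfun)"

definition blinfun_inverse :: "('a::real_normed_vector \<Rightarrow>\<^sub>L 'a) \<Rightarrow> ('a \<Rightarrow>\<^sub>L 'a)" where
  "blinfun_inverse T = (THE S. T o\<^sub>L S = id_blinfun \<and> S o\<^sub>L T = id_blinfun)"

lemma blinfun_inverse_works:
  assumes "blinfun_invertible T"
  shows "T o\<^sub>L blinfun_inverse T = id_blinfun" "blinfun_inverse T o\<^sub>L T = id_blinfun"
proof -
  obtain S where S: "T o\<^sub>L S = id_blinfun" "S o\<^sub>L T = id_blinfun"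
    using assms unfolding blinfun_invertible_def by blast
  have "R = S" if R: "T o\<^sub>L R = id_blinfun \<and> R o\<^sub>L T = id_blinfun" for R
  proof (rule blinfun_eqI)
    fix x
    have 1: "R (T (S x)) = S x"
      using arg_cong[OF conjunct2[OF R], of "\<lambda>U. blinfun_apply U (S x)"] by simp
    have "T (S x) = x"
      using arg_cong[OF S(1), of "\<lambda>U. blinfun_apply U x"] by simp
    with 1 show "R x = S x" by (simp only:)
  qed
  with S have "blinfun_inverse T = S"
    unfolding blinfun_inverse_def by (intro the_equality conjI)
  with S show "T o\<^sub>L blinfun_inverse T = id_blinfun" "blinfun_inverse T o\<^sub>L T = id_blinfun"
    by (simp_all only:)
qed

definition cocycle :: "(nat \<Rightarrow> 'a::real_normed_vector \<Rightarrow>\<^sub>L 'a) \<Rightarrow> nat \<Rightarrow> nat \<Rightarrow> ('a \<Rightarrow>\<^sub>L 'a)" where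
  "cocycle A m n =
    (if m > n then foldr (\<lambda>i T. A i o\<^sub>L T) (rev [n..<m]) id_blinfun
     else if m = n then id_blinfun
     else foldr (\<lambda>i T. blinfun_inverse (A i) o\<^sub>L T) [m..<n] id_blinfun)"

lemma cocycle_forward: "cocycle A (n + Suc d) n = A (n + d) o\<^sub>L cocycle A (n + d) n"
  by (cases d) (simp_all add: cocycle_def)

lemma cocycle_backward:
  "cocycle A m (m + Suc d) = blinfun_inverse (A m) o\<^sub>L cocycle A (Suc m) (m + Suc d)"
proof -
  have "[m..<m + Suc d] = m # [Suc m..<m + Suc d]" by (rule upt_conv_Cons) simp
  then show ?thesis by (cases d) (simp_all add: cocycle_def del: upt_Suc)
qed

text \<open>With values in the extended nonnegative reals, the supremum norm of an unbounded map is
  \<open>\<infinity>\<close> (a supremum in \<open>real\<close> would be unspecified).\<close>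

definition sup_norm :: "('a::real_normed_vector \<Rightarrow> 'a) \<Rightarrow> ennreal" where
  "sup_norm g = (SUP x. ennreal (norm (g x)))"

text \<open>The internal sum of the ranges of a family of operators (the zero space if \<open>K\<close> is empty). It is
  direct whenever the operators are projections with pairwise vanishing products.\<close>

definition sum_of_ranges :: "('k \<Rightarrow> 'a::real_normed_vector \<Rightarrow>\<^sub>L 'a) \<Rightarrow> 'k set \<Rightarrow> 'a set" where
  "sum_of_ranges P K = {\<Sum>k\<in>K. v k | v. \<forall>k\<in>K. v k \<in> range (blinfun_apply (P k))}"

definition self_homeomorphism :: "('a::topological_space \<Rightarrow> 'a) \<Rightarrow> bool" where
  "self_homeomorphism g \<longleftrightarrow> (\<exists>h. homeomorphism UNIV UNIV g h)"

end

theory Submission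
  imports Defs
begin

text \<open>Summing the stable terms forward in time and the unstable terms backward in time gives a
  kernel whose sum \<open>S n y\<close> along any orbit \<open>y\<close> is a bounded solution of the inhomogeneous linear
  equation \<open>w (n + 1) = A n (w n) + q n (y n)\<close>, where \<open>q\<close> is the non-central part of the
  perturbation. The displacement of \<open>H\<close> is the fixed point of the contraction obtained by putting
  the perturbed orbit into \<open>S\<close>; the displacement of its candidate inverse is simply \<open>- S\<close> along the
  orbits of the perturbed system. When there is no central part, the contraction estimate shows that
  the two maps are inverse to each other.\<close>

section \<open>Homeomorphisms of the whole space\<close>

lemma self_homeomorphism_iff:
  "self_homeomorphism g \<longleftrightarrow> bij g \<and> continuous_on UNIV g \<and> continuous_on UNIV (inv g)"
proof
  assume "self_homeomorphism g"
  then obtain h where h: "homeomorphism UNIV UNIV g h"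
    unfolding self_homeomorphism_def by blast
  then have "g \<circ> h = id" "h \<circ> g = id"
    by (auto simp: homeomorphism_def)
  then have "bij g" "inv g = h"
    by (auto simp: o_bij inv_unique_comp)
  with h show "bij g \<and> continuous_on UNIV g \<and> continuous_on UNIV (inv g)"
    by (auto simp: homeomorphism_def)
next
  assume "bij g \<and> continuous_on UNIV g \<and> continuous_on UNIV (inv g)"
  then have "homeomorphism UNIV UNIV g (inv g)"
    by (intro homeomorphismI) (auto simp: bij_is_inj bij_is_surj surj_f_inv_f)
  then show "self_homeomorphism g"
    unfolding self_homeomorphism_def by blast
qed

lemma self_homeomorphismI:
  assumes "continuous_on UNIV g" "continuous_on UNIV h" "g \<circ> h = id" "h \<circ> g = id"
  shows "self_homeomorphism g"
  using assms unfolding self_homeomorphism_def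
  by (intro exI[of _ h] homeomorphismI) (auto simp: fun_eq_iff)

lemma self_homeomorphism_blinfun:
  assumes "blinfun_invertible T"
  shows "self_homeomorphism (blinfun_apply T)"
proof -
  obtain S where S: "T o\<^sub>L S = id_blinfun" "S o\<^sub>L T = id_blinfun"
    using assms unfolding blinfun_invertible_def by blast
  have "T (S x) = x" "S (T x) = x" for x
    using S by (metis blinfun_apply_blinfun_compose blinfun_apply_id_blinfun id_apply)+
  then show ?thesis
    by (intro self_homeomorphismI[where h = "blinfun_apply S"])
      (auto simp: fun_eq_iff intro!: continuous_intros)
qed

section \<open>Nonautonomous evolutions\<close>

primrec flow :: "(nat \<Rightarrow> 'a \<Rightarrow> 'a) \<Rightarrow> nat \<Rightarrow> 'a \<Rightarrow> 'a" where
  "flow F 0 = id"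
| "flow F (Suc n) = F n \<circ> flow F n"

text \<open>Returning to time \<open>0\<close> before moving to time \<open>m\<close> covers forward
  and backward evolution by one formula when all \<open>F n\<close> are bijections.\<close>

definition evolution :: "(nat \<Rightarrow> 'a \<Rightarrow> 'a) \<Rightarrow> nat \<Rightarrow> nat \<Rightarrow> 'a \<Rightarrow> 'a" where
  "evolution F m n = flow F m \<circ> inv (flow F n)"

lemma bij_flow: "(\<And>n. bij (F n)) \<Longrightarrow> bij (flow F n)"
  by (induction n) (auto intro: bij_comp)

lemma evolution_refl: "(\<And>n. bij (F n)) \<Longrightarrow> evolution F n n x = x"
  by (simp add: evolution_def bij_flow bij_is_surj surj_f_inv_f)

lemma evolution_Suc:
  assumes "\<And>n. bij (F n)"
  shows "evolution F m (Suc n) (F n x) = evolution F m n x"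
  using assms by (simp add: evolution_def o_inv_distrib bij_flow bij_is_inj)

lemma continuous_on_evolution:
  assumes "\<And>n. self_homeomorphism (F n)"
  shows "continuous_on UNIV (evolution F m n)"
proof -
  have F: "bij (F n)" "continuous_on UNIV (F n)" "continuous_on UNIV (inv (F n))" for n
    using assms by (auto simp: self_homeomorphism_iff)
  have "continuous_on UNIV (flow F n)" for n
    by (induction n) (auto simp: o_def intro: continuous_on_compose2[OF F(2)])
  moreover have "continuous_on UNIV (inv (flow F n))" for n
  proof (induction n)
    case (Suc n)
    have "continuous_on UNIV (\<lambda>x. inv (flow F n) (inv (F n) x))"
      by (rule continuous_on_compose2[OF Suc F(3)]) simp
    moreover have "inv (flow F (Suc n)) = (\<lambda>x. inv (flow F n) (inv (F n) x))"
      by (simp add: o_inv_distrib F(1) bij_flow) (simp add: comp_def)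
    ultimately show ?case
      by (simp only:)
  qed simp
  ultimately show ?thesis
    unfolding evolution_def comp_def by (rule continuous_on_compose2) simp
qed

text \<open>Every orbit is the orbit of some point at time \<open>0\<close>, and from there the
  one-step relation can be iterated forward. This settles backward times too.\<close>

lemma evolution_conjugacy:
  assumes "\<And>n. bij (F n)" "\<And>n. bij (G n)"
    and conj: "\<And>n x. h (Suc n) (F n x) = G n (h n x)"
  shows "h m (evolution F m n x) = evolution G m n (h n x)"
proof -
  have h: "h n (flow F n u) = flow G n (h 0 u)" for n u
    by (induction n) (simp_all add: conj)
  define u where "u = inv (flow F n) x"
  have "x = flow F n u"
    using assms by (simp add: u_def bij_flow bij_is_surj surj_f_inv_f)
  with assms show ?thesis
    by (simp add: evolution_def h bij_flow bij_is_inj)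
qed

section \<open>Perturbations with a contracting Green kernel\<close>

text \<open>\<open>\<phi> n j x\<close> is the contribution at time \<open>n\<close> of the
  perturbation met at time \<open>j\<close> in state \<open>x\<close>; its jump at
  \<open>j = n\<close> is \<open>q n\<close>. \<open>b\<close> and \<open>c\<close> bound its size
  and its Lipschitz constant, so \<open>C\<close> will bound displacements and
  \<open>\<theta>\<close> is the contraction factor. \<open>F\<close> and \<open>q\<close> are kept
  separate because \<open>F n x - A n x - q n x\<close> is the central part in the
  application.\<close>

locale green_kernel =
  fixes A :: "nat \<Rightarrow> 'a::banach \<Rightarrow>\<^sub>L 'a"
    and F q :: "nat \<Rightarrow> 'a \<Rightarrow> 'a"
    and \<phi> :: "nat \<Rightarrow> nat \<Rightarrow> 'a \<Rightarrow> 'a"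
    and b c :: "nat \<Rightarrow> nat \<Rightarrow> real"
    and C \<theta> :: real
  assumes A_homeo: "\<And>n. self_homeomorphism (blinfun_apply (A n))"
    and F_homeo: "\<And>n. self_homeomorphism (F n)"
    and \<phi>_cont: "\<And>n j. continuous_on UNIV (\<phi> n j)"
    and \<phi>_bound: "\<And>n j x. norm (\<phi> n j x) \<le> b n j"
    and \<phi>_lipschitz: "\<And>n j x y. norm (\<phi> n j x - \<phi> n j y) \<le> c n j * norm (x - y)"
    and \<phi>_Suc: "\<And>n j x. \<phi> (Suc n) j x = A n (\<phi> n j x) + (if j = n then q n x else 0)"
    and b_summable: "\<And>n. summable (b n)"
    and b_suminf: "\<And>n. suminf (b n) \<le> C"
    and c_nonneg: "\<And>n j. c n j \<ge> 0"
    and c_summable: "\<And>n. summable (c n)"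
    and c_suminf: "\<And>n. suminf (c n) \<le> \<theta>"
    and \<theta>_less: "\<theta> < 1"
begin

lemma A_bij: "bij (blinfun_apply (A n))"
  and F_bij: "bij (F n)"
  using A_homeo F_homeo by (auto simp: self_homeomorphism_iff)

abbreviation evA :: "nat \<Rightarrow> nat \<Rightarrow> 'a \<Rightarrow> 'a" where
  "evA \<equiv> evolution (\<lambda>n. blinfun_apply (A n))"

abbreviation evF :: "nat \<Rightarrow> nat \<Rightarrow> 'a \<Rightarrow> 'a" where
  "evF \<equiv> evolution F"

section \<open>Estimates for the kernel sum\<close>

definition S :: "nat \<Rightarrow> (nat \<Rightarrow> 'a) \<Rightarrow> 'a" where
  "S n y = (\<Sum>j. \<phi> n j (y j))"

lemma norm_summable_\<phi>: "summable (\<lambda>j. norm (\<phi> n j (y j)))"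
  by (rule summable_comparison_test[OF _ b_summable[of n]]) (auto intro: \<phi>_bound)

lemma summable_\<phi>: "summable (\<lambda>j. \<phi> n j (y j))"
  using norm_summable_\<phi> by (rule summable_norm_cancel)

lemma norm_S_le: "norm (S n y) \<le> C"
proof -
  have "norm (S n y) \<le> (\<Sum>j. norm (\<phi> n j (y j)))"
    unfolding S_def by (rule summable_norm[OF norm_summable_\<phi>])
  also have "\<dots> \<le> suminf (b n)"
    by (rule suminf_le[OF _ norm_summable_\<phi> b_summable]) (rule \<phi>_bound)
  finally show ?thesis
    using b_suminf[of n] by simp
qed

text \<open>The Lipschitz constants of the terms sum to at most \<open>\<theta>\<close>, so
  \<open>S n\<close> contracts the uniform distance between sequences.\<close>

lemma S_lipschitz:
  assumes "\<And>j. norm (y j - z j) \<le> M"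
  shows "norm (S n y - S n z) \<le> \<theta> * M"
proof -
  have M: "M \<ge> 0"
    using assms[of 0] norm_ge_zero order_trans by blast
  have le: "norm (\<phi> n j (y j) - \<phi> n j (z j)) \<le> c n j * M" for j
    using \<phi>_lipschitz[of n j "y j" "z j"] mult_left_mono[OF assms[of j] c_nonneg[of n j]]
    by (rule order_trans)
  have sum: "summable (\<lambda>j. c n j * M)"
    by (rule summable_mult2[OF c_summable])
  have sum': "summable (\<lambda>j. norm (\<phi> n j (y j) - \<phi> n j (z j)))"
    by (rule summable_comparison_test[OF _ sum]) (auto intro: le)
  have "norm (S n y - S n z) = norm (\<Sum>j. \<phi> n j (y j) - \<phi> n j (z j))"
    unfolding S_def by (simp add: suminf_diff summable_\<phi>)
  also have "\<dots> \<le> (\<Sum>j. norm (\<phi> n j (y j) - \<phi> n j (z j)))"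
    by (rule summable_norm[OF sum'])
  also have "\<dots> \<le> (\<Sum>j. c n j * M)"
    by (rule suminf_le[OF le sum' sum])
  also have "\<dots> = suminf (c n) * M"
    by (rule suminf_mult2[OF c_summable, symmetric])
  also have "\<dots> \<le> \<theta> * M"
    by (rule mult_right_mono[OF c_suminf M])
  finally show ?thesis .
qed

text \<open>\<open>A n\<close> passes through the series by bounded linearity, and the jump of the
  kernel contributes only at \<open>j = n\<close>.\<close>

lemma S_Suc: "S (Suc n) y = A n (S n y) + q n (y n)"
proof -
  have "(\<lambda>j. A n (\<phi> n j (y j)) + (if j = n then q n (y j) else 0)) sums (A n (S n y) + q n (y n))"
    unfolding S_def
    by (intro sums_add sums_single bounded_linear.sums[OF blinfun.bounded_linear_right] summable_sums summable_\<phi>)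
  then show ?thesis
    unfolding S_def by (simp add: \<phi>_Suc sums_iff)
qed

text \<open>The bounds \<open>b n j\<close> do not depend on the point, so the partial sums converge
  uniformly.\<close>

lemma continuous_on_S:
  assumes "\<And>j. continuous_on UNIV (Y j)"
  shows "continuous_on UNIV (\<lambda>x. S n (\<lambda>j. Y j x))"
proof -
  have "uniform_limit UNIV (\<lambda>N x. \<Sum>j<N. \<phi> n j (Y j x)) (\<lambda>x. \<Sum>j. \<phi> n j (Y j x)) sequentially"
    by (rule Weierstrass_m_test[OF _ b_summable]) (rule \<phi>_bound)
  moreover have "continuous_on UNIV (\<lambda>x. \<Sum>j<N. \<phi> n j (Y j x))" for N
    by (intro continuous_on_sum continuous_on_compose2[OF \<phi>_cont] assms) auto
  ultimately show ?thesis
    unfolding S_def by (intro uniform_limit_theorem[where F = sequentially]) auto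
qed

lemma \<theta>_nonneg: "\<theta> \<ge> 0"
  using suminf_nonneg[OF c_summable c_nonneg] c_suminf order_trans by blast

section \<open>The fixed point equation for the displacement\<close>

text \<open>Picard iteration started at zero. The equation at time \<open>n\<close> involves the
  unknown at all times \<open>j\<close>, so estimates must be uniform in time.\<close>

primrec iterate :: "nat \<Rightarrow> nat \<Rightarrow> 'a \<Rightarrow> 'a" where
  "iterate 0 n x = 0"
| "iterate (Suc i) n x = S n (\<lambda>j. evA j n x + iterate i j (evA j n x))"

lemma continuous_on_iterate: "continuous_on UNIV (iterate i n)"
proof (induction i arbitrary: n)
  case (Suc i)
  have "continuous_on UNIV (evA j n)" for j
    by (rule continuous_on_evolution[OF A_homeo])
  then have "continuous_on UNIV (\<lambda>x. S n (\<lambda>j. evA j n x + iterate i j (evA j n x)))"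
    by (intro continuous_on_S continuous_on_add continuous_on_compose2[OF Suc]) auto
  then show ?case
    by simp
qed simp

text \<open>The first difference is a value of \<open>S\<close>, hence at most \<open>C\<close>;
  each further step gains a factor \<open>\<theta>\<close>.\<close>

lemma norm_iterate_diff_le: "norm (iterate (Suc i) n x - iterate i n x) \<le> \<theta> ^ i * C"
proof (induction i arbitrary: n x)
  case 0
  show ?case
    by (simp add: norm_S_le)
next
  case (Suc i)
  \<comment> \<open>The summand \<open>evA j n x\<close> cancels between the two sequences, leaving
    the induction hypothesis at time \<open>j\<close> and point \<open>evA j n x\<close>.\<close>
  then show ?case
    unfolding iterate.simps(2)[of "Suc i"] iterate.simps(2)[of i n] power_Suc mult.assoc
    by (intro S_lipschitz) (simp del: iterate.simps)
qed

lemma ex_fixed_point: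
  "\<exists>h :: nat \<Rightarrow> 'a \<Rightarrow> 'a. (\<forall>n. continuous_on UNIV (h n)) \<and>
    (\<forall>n x. h n x = S n (\<lambda>j. evA j n x + h j (evA j n x)))"
proof -
  \<comment> \<open>The limit of the iterates, written as a telescoping series with geometric
    bounds.\<close>
  define h where "h n x = (\<Sum>i. iterate (Suc i) n x - iterate i n x)" for n x
  \<comment> \<open>Time and point are paired in \<open>z\<close>, which makes the convergence
    uniform in time as well.\<close>
  have "uniform_limit UNIV (\<lambda>N z. \<Sum>i<N. iterate (Suc i) (fst z) (snd z) - iterate i (fst z) (snd z))
      (\<lambda>z. \<Sum>i. iterate (Suc i) (fst z) (snd z) - iterate i (fst z) (snd z)) sequentially"
    using \<theta>_nonneg \<theta>_less
    by (intro Weierstrass_m_test[OF norm_iterate_diff_le] summable_mult2 summable_geometric) auto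
  moreover have "(\<Sum>i<N. iterate (Suc i) n x - iterate i n x) = iterate N n x" for N n x
    by (subst sum_lessThan_telescope) simp
  ultimately have unif: "uniform_limit UNIV (\<lambda>N z. iterate N (fst z) (snd z)) (\<lambda>z. h (fst z) (snd z)) sequentially"
    by (simp only: h_def)
  have unif_n: "uniform_limit UNIV (\<lambda>N. iterate N n) (h n) sequentially" for n
    using uniform_limit_compose'[OF unif, of "\<lambda>x. (n, x)" UNIV] by simp
  have "h n x = S n (\<lambda>j. evA j n x + h j (evA j n x))" for n x
  proof (rule LIMSEQ_unique)
    show "(\<lambda>N. iterate (Suc N) n x) \<longlonglongrightarrow> h n x"
      by (rule LIMSEQ_Suc[OF tendsto_uniform_limitI[OF unif_n]]) simp
    show "(\<lambda>N. iterate (Suc N) n x) \<longlonglongrightarrow> S n (\<lambda>j. evA j n x + h j (evA j n x))"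
    proof (rule tendstoI)
      fix e :: real
      assume "e > 0"
      \<comment> \<open>Joint uniformity is essential here: the iterate must be
        \<open>e\<close>-close to \<open>h\<close> at all times \<open>j\<close> at once before
        \<open>S_lipschitz\<close> applies.\<close>
      from uniform_limitD[OF unif this]
      show "\<forall>\<^sub>F N in sequentially.
          dist (iterate (Suc N) n x) (S n (\<lambda>j. evA j n x + h j (evA j n x))) < e"
      proof eventually_elim
        case (elim N)
        then have "norm (iterate N j y - h j y) \<le> e" for j y
          by (auto simp: dist_norm less_imp_le)
        then have "dist (iterate (Suc N) n x) (S n (\<lambda>j. evA j n x + h j (evA j n x))) \<le> \<theta> * e"
          unfolding iterate.simps dist_norm by (intro S_lipschitz) simp
        also have "\<dots> < e"
          using \<theta>_less \<open>e > 0\<close> by simp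
        finally show ?case .
      qed
    qed
  qed
  moreover have "continuous_on UNIV (h n)" for n
    by (rule uniform_limit_theorem[OF _ unif_n]) (simp_all add: continuous_on_iterate)
  ultimately show ?thesis
    by blast
qed

section \<open>The two maps and their conjugacy equations\<close>

definition h :: "nat \<Rightarrow> 'a \<Rightarrow> 'a" where
  "h = (SOME h. (\<forall>n. continuous_on UNIV (h n)) \<and>
    (\<forall>n x. h n x = S n (\<lambda>j. evA j n x + h j (evA j n x))))"

definition H :: "nat \<Rightarrow> 'a \<Rightarrow> 'a" where
  "H n x = x + h n x"

definition H' :: "nat \<Rightarrow> 'a \<Rightarrow> 'a" where
  "H' n x = x - S n (\<lambda>j. evF j n x)"

lemma h_cont: "continuous_on UNIV (h n)"
  and h_eq: "h n x = S n (\<lambda>j. H j (evA j n x))"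
  using someI_ex[OF ex_fixed_point] unfolding H_def h_def[symmetric] by blast+

lemma H_cont: "continuous_on UNIV (H n)"
  unfolding H_def by (intro continuous_intros h_cont)

lemma H'_cont: "continuous_on UNIV (H' n)"
  unfolding H'_def
  by (intro continuous_intros continuous_on_S continuous_on_evolution[OF F_homeo])

lemma H_near_id: "norm (H n x - x) \<le> C"
  using norm_S_le[of n "\<lambda>j. H j (evA j n x)"] by (simp add: h_eq[symmetric]) (simp add: H_def)

lemma H'_near_id: "norm (H' n x - x) \<le> C"
  by (simp add: H'_def norm_S_le)

text \<open>The \<open>A\<close>-orbit through \<open>A n x\<close> at time \<open>n + 1\<close> is
  the one through \<open>x\<close> at time \<open>n\<close>, so \<open>S_Suc\<close> compares two
  sums along the same sequence.\<close>

lemma H_Suc: "H (Suc n) (A n x) = A n (H n x) + q n (H n x)"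
proof -
  have "h (Suc n) (A n x) = S (Suc n) (\<lambda>j. H j (evA j n x))"
    by (simp add: h_eq evolution_Suc[where F = "\<lambda>n. blinfun_apply (A n)", OF A_bij])
  also have "\<dots> = A n (h n x) + q n (H n x)"
    by (simp add: S_Suc h_eq[symmetric] evolution_refl[where F = "\<lambda>n. blinfun_apply (A n)", OF A_bij])
  finally show ?thesis
    by (simp add: H_def blinfun.add_right)
qed

text \<open>The same comparison along an \<open>F\<close>-orbit; the remainder collects what
  \<open>q\<close> does not capture of the perturbation.\<close>

lemma H'_Suc: "H' (Suc n) (F n x) = A n (H' n x) + (F n x - A n x - q n x)"
proof -
  have "S (Suc n) (\<lambda>j. evF j (Suc n) (F n x)) = A n (S n (\<lambda>j. evF j n x)) + q n x"
    by (simp add: S_Suc evolution_Suc[where F = F, OF F_bij] evolution_refl[where F = F, OF F_bij])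
  then show ?thesis
    by (simp add: H'_def blinfun.diff_right)
qed

section \<open>Mutual inverses when there is no central part\<close>

context
  assumes F_eq: "\<And>n x. F n x = A n x + q n x"
begin

text \<open>\<open>H\<close> carries \<open>A\<close>-orbits to \<open>F\<close>-orbits, so the sum
  subtracted by \<open>H'\<close> at \<open>H n x\<close> is exactly the displacement
  \<open>h n x\<close>.\<close>

lemma H'_H: "H' n (H n x) = x"
proof -
  have "evF j n (H n x) = H j (evA j n x)" for j
    by (rule evolution_conjugacy[OF A_bij F_bij, symmetric]) (simp add: H_Suc F_eq)
  then show ?thesis
    by (simp add: H'_def h_eq[symmetric]) (simp add: H_def)
qed

text \<open>The displacement of \<open>H\<close> after \<open>H'\<close> is bounded, and it is a
  difference of two kernel sums whose arguments differ by that same displacement along an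
  \<open>F\<close>-orbit. Contraction forces it to vanish.\<close>

lemma H_H': "H n (H' n x) = x"
proof -
  define w where "w n x = H n (H' n x) - x" for n x
  have w: "w n x = S n (\<lambda>j. H j (H' j (evF j n x))) - S n (\<lambda>j. evF j n x)" for n x
  proof -
    have "H' (Suc m) (F m y) = A m (H' m y)" for m y
      using H'_Suc[of m y] F_eq[of m y] by simp
    then have "evA j n (H' n x) = H' j (evF j n x)" for j
      by (intro evolution_conjugacy[OF F_bij A_bij, symmetric])
    then have "h n (H' n x) = S n (\<lambda>j. H j (H' j (evF j n x)))"
      by (simp add: h_eq)
    moreover have "w n x = h n (H' n x) - S n (\<lambda>j. evF j n x)"
      by (simp add: w_def H_def) (simp add: H'_def)
    ultimately show ?thesis
      by simp
  qed
  \<comment> \<open>Two values of \<open>S\<close> give the initial bound \<open>2 * C\<close>; each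
    use of the identity for \<open>w\<close> improves it by \<open>\<theta>\<close>.\<close>
  have "norm (w n x) \<le> \<theta> ^ i * (2 * C)" for i n x
  proof (induction i arbitrary: n x)
    case 0
    have "norm (w n x) \<le> C + C"
      unfolding w by (rule order_trans[OF norm_triangle_ineq4 add_mono[OF norm_S_le norm_S_le]])
    then show ?case
      by simp
  next
    case (Suc i)
    then have "norm (H j (H' j y) - y) \<le> \<theta> ^ i * (2 * C)" for j y
      by (simp add: w_def)
    then show ?case
      unfolding w power_Suc mult.assoc by (intro S_lipschitz)
  qed
  moreover have "(\<lambda>i. \<theta> ^ i * (2 * C)) \<longlonglongrightarrow> 0 * (2 * C)"
    using \<theta>_nonneg \<theta>_less by (intro tendsto_mult LIMSEQ_power_zero tendsto_const) auto
  ultimately have "norm (w n x) \<le> 0 * (2 * C)"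
    by (intro LIMSEQ_le_const) auto
  then show ?thesis
    by (simp add: w_def)
qed

lemma self_homeomorphism_H: "self_homeomorphism (H n)"
  by (rule self_homeomorphismI[OF H_cont[of n] H'_cont[of n]]) (auto simp: H'_H H_H')

lemma self_homeomorphism_H': "self_homeomorphism (H' n)"
  by (rule self_homeomorphismI[OF H'_cont[of n] H_cont[of n]]) (auto simp: H'_H H_H')

end

end

section \<open>The Green kernel of a generalized dichotomy\<close>

lemma cocycle_refl: "cocycle A n n = id_blinfun"
  by (simp add: cocycle_def)

text \<open>For \<open>l \<le> n\<close> this is the forward recursion; for \<open>l > n\<close> the
  factor \<open>A n\<close> cancels the outermost inverse.\<close>

lemma cocycle_Suc:
  assumes "blinfun_invertible (A n)"
  shows "cocycle A (Suc n) l = A n o\<^sub>L cocycle A n l"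
proof (cases "l \<le> n")
  case True
  then show ?thesis
    using cocycle_forward[of A l "n - l"] by simp
next
  case False
  then have "cocycle A n l = blinfun_inverse (A n) o\<^sub>L cocycle A (Suc n) l"
    using cocycle_backward[of A n "l - Suc n"] by simp
  moreover have "A n (blinfun_inverse (A n) x) = x" for x
    using arg_cong[OF blinfun_inverse_works(1)[OF assms], of "\<lambda>T. blinfun_apply T x"] by simp
  ultimately show ?thesis
    by (intro blinfun_eqI) simp
qed

text \<open>Index \<open>j\<close> is the term \<open>l = j + 1\<close> of the dichotomy sums, so that it acts on the value of \<open>f j\<close>.\<close>

definition green ::
  "(nat \<Rightarrow> 'a::real_normed_vector \<Rightarrow>\<^sub>L 'a) \<Rightarrow> ('k \<Rightarrow> nat \<Rightarrow> 'a \<Rightarrow>\<^sub>L 'a) \<Rightarrow> 'k set \<Rightarrow>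
    'k \<Rightarrow> nat \<Rightarrow> nat \<Rightarrow> 'a \<Rightarrow>\<^sub>L 'a" where
  "green A P Ks k n j =
    (if k \<in> Ks then (if j < n then cocycle A n (Suc j) o\<^sub>L P k (Suc j) else 0)
     else (if j < n then 0 else - (cocycle A n (Suc j) o\<^sub>L P k (Suc j))))"

text \<open>When time passes from \<open>n\<close> to \<open>n + 1\<close>, at \<open>j = n\<close>
  a stable term switches on with value \<open>P k (Suc n)\<close>, while an unstable one, carried by
  \<open>A n\<close> to \<open>- P k (Suc n)\<close>, switches off. Both jumps are the same.\<close>

lemma green_Suc:
  assumes "blinfun_invertible (A n)"
  shows "green A P Ks k (Suc n) j = (A n o\<^sub>L green A P Ks k n j) + (if j = n then P k (Suc n) else 0)"
proof (rule blinfun_eqI)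
  fix x
  have "A n (cocycle A n (Suc n) y) = y" for y
    using cocycle_Suc[of A n "Suc n", OF assms]
    by (metis blinfun_apply_blinfun_compose blinfun_apply_id_blinfun cocycle_refl id_apply)
  then show "blinfun_apply (green A P Ks k (Suc n) j) x =
      ((A n o\<^sub>L green A P Ks k n j) + (if j = n then P k (Suc n) else 0)) x"
  proof (cases "j = n")
    case True
    with \<open>\<And>y. A n (cocycle A n (Suc n) y) = y\<close> show ?thesis
      by (simp add: green_def cocycle_refl plus_blinfun.rep_eq uminus_blinfun.rep_eq
          blinfun.minus_right)
  next
    case False
    then show ?thesis
      by (auto simp: green_def less_Suc_eq uminus_blinfun.rep_eq blinfun.minus_right
          cocycle_Suc[of A n "Suc j", OF assms])
  qed
qed

text \<open>Only \<open>j < n\<close> contributes, and \<open>l = j + 1\<close> gives the dichotomy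
  sum. The weight \<open>r\<close> will be either \<open>\<mu> k\<close> or
  \<open>\<nu> k\<close>.\<close>

lemma green_sum_bounds_stable:
  fixes r :: "nat \<Rightarrow> real"
  assumes "k \<in> Ks" "\<And>l. r l \<ge> 0" "L \<ge> 0"
    and "(SUP n. \<Sum>l=1..n. ennreal (norm (cocycle A n l o\<^sub>L P k l) * r l)) \<le> ennreal L"
  shows "summable (\<lambda>j. norm (green A P Ks k n j) * r (Suc j))"
    and "(\<Sum>j. norm (green A P Ks k n j) * r (Suc j)) \<le> L"
proof -
  let ?g = "\<lambda>j. norm (green A P Ks k n j) * r (Suc j)"
  have g0: "?g j = 0" if "j \<notin> {..<n}" for j
    using that assms(1) by (simp add: green_def)
  show "summable ?g"
    by (rule summable_finite[of "{..<n}"]) (use g0 in auto)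
  have "suminf ?g = (\<Sum>j<n. ?g j)"
    by (rule suminf_finite) (use g0 in auto)
  also have "\<dots> = (\<Sum>j<n. norm (cocycle A n (Suc j) o\<^sub>L P k (Suc j)) * r (Suc j))"
    by (rule sum.cong) (auto simp: green_def assms(1))
  also have "\<dots> = (\<Sum>l=1..n. norm (cocycle A n l o\<^sub>L P k l) * r l)"
    by (simp add: sum.atLeast1_atMost_eq)
  finally have "ennreal (suminf ?g) = (\<Sum>l=1..n. ennreal (norm (cocycle A n l o\<^sub>L P k l) * r l))"
    using assms(2) by (simp add: sum_ennreal)
  also have "\<dots> \<le> ennreal L"
    using assms(4) by (simp add: SUP_le_iff)
  finally show "suminf ?g \<le> L"
    using assms(3) by simp
qed

text \<open>Terms with \<open>j < n\<close> vanish; the rest is the dichotomy tail with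
  \<open>j = i + n\<close>, whose finite extended value yields summability over the reals.\<close>

lemma green_sum_bounds_unstable:
  fixes r :: "nat \<Rightarrow> real"
  assumes "k \<notin> Ks" "\<And>l. r l \<ge> 0" "L \<ge> 0"
    and "(SUP n. \<Sum>i. ennreal (norm (cocycle A n (n + 1 + i) o\<^sub>L P k (n + 1 + i)) * r (n + 1 + i)))
      \<le> ennreal L"
  shows "summable (\<lambda>j. norm (green A P Ks k n j) * r (Suc j))"
    and "(\<Sum>j. norm (green A P Ks k n j) * r (Suc j)) \<le> L"
proof -
  let ?g = "\<lambda>j. norm (green A P Ks k n j) * r (Suc j)"
  have shift: "?g (i + n) = norm (cocycle A n (n + 1 + i) o\<^sub>L P k (n + 1 + i)) * r (n + 1 + i)" for i
    using assms(1) by (simp add: green_def add.commute)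
  have le: "(\<Sum>i. ennreal (?g (i + n))) \<le> ennreal L"
    unfolding shift using assms(4) by (simp add: SUP_le_iff)
  have pos: "?g j \<ge> 0" for j
    using assms(2) by simp
  have fin: "(\<Sum>i. ennreal (?g (i + n))) \<noteq> top"
    using le by (auto simp: top_unique)
  have "summable (\<lambda>i. ?g (i + n))"
    by (rule summable_suminf_not_top[OF pos fin])
  then show sum: "summable ?g"
    by (subst (asm) summable_iff_shift)
  have "(\<Sum>j<n. ?g j) = 0"
    using assms(1) by (simp add: green_def)
  then have "suminf ?g = (\<Sum>i. ?g (i + n))"
    using suminf_split_initial_segment[OF sum, of n] by simp
  moreover have "ennreal (\<Sum>i. ?g (i + n)) \<le> ennreal L"
    using le suminf_ennreal[OF pos fin] by simp
  ultimately show "suminf ?g \<le> L"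
    using assms(3) by simp
qed

lemma SUP_sup_norm_finite:
  assumes "\<And>n x. norm (g n x) \<le> C"
  shows "(SUP n. sup_norm (g n)) < \<infinity>"
proof -
  have "(SUP n. sup_norm (g n)) \<le> ennreal C"
    unfolding sup_norm_def by (intro SUP_least ennreal_leI assms)
  then show ?thesis
    by (auto intro: order_le_less_trans)
qed

lemma less_infinity_ennrealE:
  assumes "x < (\<infinity>::ennreal)"
  obtains C where "C \<ge> 0" "x \<le> ennreal C"
  using assms by (cases x) auto

section \<open>The dichotomy as an instance of the abstract kernel\<close>

theorem theorem1:
  fixes A :: "nat \<Rightarrow> 'a::banach \<Rightarrow>\<^sub>L 'a"
    and K Ks Ku Kc :: "'k set"
    and P :: "'k \<Rightarrow> nat \<Rightarrow> 'a \<Rightarrow>\<^sub>L 'a"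
    and lam :: "'k \<Rightarrow> real"
    and \<mu> \<nu> :: "'k \<Rightarrow> nat \<Rightarrow> real"
    and f :: "nat \<Rightarrow> 'a \<Rightarrow> 'a"
  assumes A_invertible: "\<And>n. blinfun_invertible (A n)"
    and K_finite: "finite K"
    and K_eq: "K = Ks \<union> Ku \<union> Kc"
    and K_disjoint: "Ks \<inter> Ku = {}" "Ks \<inter> Kc = {}" "Ku \<inter> Kc = {}"
    and P_proj: "\<And>k n. k \<in> K \<Longrightarrow> P k n o\<^sub>L P k n = P k n"
    and P_sum: "\<And>n. (\<Sum>k\<in>K. P k n) = id_blinfun"
    and P_prod: "\<And>k l n. k \<in> K \<Longrightarrow> l \<in> K \<Longrightarrow> k \<noteq> l \<Longrightarrow> P k n o\<^sub>L P l n = 0"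
    and lam_pos: "\<And>k. k \<in> Ks \<union> Ku \<Longrightarrow> lam k > 0"
    and \<mu>_pos: "\<And>k n. k \<in> Ks \<union> Ku \<Longrightarrow> \<mu> k n > 0"
    and \<nu>_pos: "\<And>k n. k \<in> Ks \<union> Ku \<Longrightarrow> \<nu> k n > 0"
    and s_\<nu>: "\<And>k. k \<in> Ks \<Longrightarrow>
      (SUP n. \<Sum>l=1..n. ennreal (norm (cocycle A n l o\<^sub>L P k l) * \<nu> k l)) < \<infinity>"
    and s_\<mu>: "\<And>k. k \<in> Ks \<Longrightarrow>
      (SUP n. \<Sum>l=1..n. ennreal (norm (cocycle A n l o\<^sub>L P k l) * \<mu> k l)) \<le> ennreal (lam k)"
    and u_\<nu>: "\<And>k. k \<in> Ku \<Longrightarrow>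
      (SUP n. \<Sum>i. ennreal (norm (cocycle A n (n + 1 + i) o\<^sub>L P k (n + 1 + i)) * \<nu> k (n + 1 + i)))
        < \<infinity>"
    and u_\<mu>: "\<And>k. k \<in> Ku \<Longrightarrow>
      (SUP n. \<Sum>i. ennreal (norm (cocycle A n (n + 1 + i) o\<^sub>L P k (n + 1 + i)) * \<mu> k (n + 1 + i)))
        \<le> ennreal (lam k)"
    and f_homeo: "\<And>n. self_homeomorphism (\<lambda>x. A n x + f n x)"
    and f_bound: "\<And>k n. k \<in> Ks \<union> Ku \<Longrightarrow> n \<ge> 1 \<Longrightarrow>
      sup_norm (\<lambda>x. P k n (f (n - 1) x)) \<le> ennreal (\<nu> k n)"
    and f_lipschitz: "\<And>k n x y. k \<in> Ks \<union> Ku \<Longrightarrow> n \<ge> 1 \<Longrightarrow>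
      norm (P k n (f (n - 1) x) - P k n (f (n - 1) y)) \<le> \<mu> k n * norm (x - y)"
    and lam_sum: "(\<Sum>k\<in>Ks \<union> Ku. lam k) < 1"
  shows "\<exists>H \<tau> H' \<tau>' :: nat \<Rightarrow> 'a \<Rightarrow> 'a.
    \<comment> \<open>(i)\<close>
    ((\<forall>n. continuous_on UNIV (H n)) \<and>
     (\<forall>n. continuous_on UNIV (\<tau> n) \<and> range (\<tau> n) \<subseteq> sum_of_ranges (\<lambda>k. P k (n + 1)) Kc) \<and>
     (\<forall>n. H (n + 1) \<circ> A n = (\<lambda>x. (A n (H n x) + f n (H n x)) + \<tau> n (H n x))) \<and>
     (SUP n. sup_norm (\<lambda>x. H n x - x)) < \<infinity> \<and>
     (\<forall>n x. \<tau> n x = - (\<Sum>k\<in>Kc. P k (n + 1) (f n x)))) \<and>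
    \<comment> \<open>(ii)\<close>
    ((\<forall>n. continuous_on UNIV (H' n)) \<and>
     (\<forall>n. continuous_on UNIV (\<tau>' n) \<and> range (\<tau>' n) \<subseteq> sum_of_ranges (\<lambda>k. P k (n + 1)) Kc) \<and>
     (\<forall>n. H' (n + 1) \<circ> (\<lambda>x. A n x + f n x) = (\<lambda>x. A n (H' n x) + \<tau>' n x)) \<and>
     (SUP n. sup_norm (\<lambda>x. H' n x - x)) < \<infinity> \<and>
     (\<forall>n x. \<tau>' n x = - \<tau> n x \<and> \<tau>' n x = (\<Sum>k\<in>Kc. P k (n + 1) (f n x)))) \<and>
    \<comment> \<open>the case of a vanishing central part\<close>
    (Kc = {} \<or> (\<forall>k\<in>Kc. \<forall>n\<ge>1. \<forall>x. P k n (f (n - 1) x) = 0) \<longrightarrow>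
      (\<forall>n. self_homeomorphism (H n) \<and> self_homeomorphism (H' n) \<and>
           H n \<circ> H' n = id \<and> H' n \<circ> H n = id \<and>
           H (n + 1) \<circ> A n = (\<lambda>x. A n x + f n x) \<circ> H n))"
proof -
  \<comment> \<open>The non-central indices. On \<open>Kh\<close>, the indices outside
    \<open>Ks\<close> are those in \<open>Ku\<close>, as the second branch of \<open>green\<close>
    expects.\<close>
  define Kh where "Kh = Ks \<union> Ku"
  have Kh: "finite Kh" "finite Kc" "Kh \<inter> Kc = {}" "K = Kh \<union> Kc" "Kh \<subseteq> K"
    using K_finite K_eq K_disjoint by (auto simp: Kh_def)
  define F where "F n x = A n x + f n x" for n x
  define g where "g = green A P Ks"
  define q where "q n x = (\<Sum>k\<in>Kh. P k (Suc n) (f n x))" for n x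
  define \<phi> where "\<phi> n j x = (\<Sum>k\<in>Kh. g k n j (f j x))" for n j x
  have F_homeo: "self_homeomorphism (F n)" for n
    using f_homeo unfolding F_def .
  have f_cont: "continuous_on UNIV (f n)" for n
  proof -
    have "continuous_on UNIV (\<lambda>x. F n x - A n x)"
      using F_homeo[of n] by (intro continuous_intros) (auto simp: self_homeomorphism_iff)
    then show ?thesis
      by (simp add: F_def)
  qed
  have f_split: "f n x = q n x + (\<Sum>k\<in>Kc. P k (Suc n) (f n x))" for n x
  proof -
    have "f n x = (\<Sum>k\<in>K. P k (Suc n)) (f n x)"
      by (simp add: P_sum)
    then show ?thesis
      using Kh by (simp add: q_def plus_blinfun.rep_eq blinfun.sum_left sum.union_disjoint)
  qed
  \<comment> \<open>Each kernel term ends in a projection, so idempotence supplies a second copy of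
    it. This lets the bounds on the projected perturbation combine with the operator norms in the
    dichotomy sums.\<close>
  have g_P: "norm (g k n j x) \<le> norm (g k n j) * norm (P k (Suc j) x)" if "k \<in> Kh" for k n j x
  proof -
    have "P k (Suc j) (P k (Suc j) x) = P k (Suc j) x"
      using P_proj[of k "Suc j"] that Kh by (metis blinfun_apply_blinfun_compose subsetD)
    then have "g k n j x = g k n j (P k (Suc j) x)"
      by (simp add: g_def green_def uminus_blinfun.rep_eq)
    then show ?thesis
      using norm_blinfun by metis
  qed
  \<comment> \<open>The weights \<open>\<nu>\<close> come only with finite suprema, so a bound
    \<open>C k\<close> uniform in \<open>n\<close> is chosen for each index; their sum bounds the
    displacement.\<close>
  have "\<forall>k\<in>Kh. \<exists>C. \<forall>n. summable (\<lambda>j. norm (g k n j) * \<nu> k (Suc j)) \<and>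
      (\<Sum>j. norm (g k n j) * \<nu> k (Suc j)) \<le> C"
  proof
    fix k
    assume k: "k \<in> Kh"
    then have pos: "\<nu> k l \<ge> 0" for l
      using \<nu>_pos[of k l] by (simp add: Kh_def)
    show "\<exists>C. \<forall>n. summable (\<lambda>j. norm (g k n j) * \<nu> k (Suc j)) \<and>
      (\<Sum>j. norm (g k n j) * \<nu> k (Suc j)) \<le> C"
    proof (cases "k \<in> Ks")
      case True
      from s_\<nu>[OF this] obtain C where "C \<ge> 0"
        "(SUP n. \<Sum>l=1..n. ennreal (norm (cocycle A n l o\<^sub>L P k l) * \<nu> k l)) \<le> ennreal C"
        by (rule less_infinity_ennrealE)
      from green_sum_bounds_stable[where P = P and r = "\<nu> k", OF True pos this] show ?thesis
        unfolding g_def by blast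
    next
      case False
      with k have "k \<in> Ku"
        by (simp add: Kh_def)
      from u_\<nu>[OF this] obtain C where "C \<ge> 0"
        "(SUP n. \<Sum>i. ennreal (norm (cocycle A n (n + 1 + i) o\<^sub>L P k (n + 1 + i))
          * \<nu> k (n + 1 + i))) \<le> ennreal C"
        by (rule less_infinity_ennrealE)
      from green_sum_bounds_unstable[where P = P and r = "\<nu> k", OF False pos this] show ?thesis
        unfolding g_def by blast
    qed
  qed
  then obtain C where C: "\<And>k n. k \<in> Kh \<Longrightarrow> summable (\<lambda>j. norm (g k n j) * \<nu> k (Suc j))"
    "\<And>k n. k \<in> Kh \<Longrightarrow> (\<Sum>j. norm (g k n j) * \<nu> k (Suc j)) \<le> C k"
    by metis
  have L: "summable (\<lambda>j. norm (g k n j) * \<mu> k (Suc j)) \<and>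
      (\<Sum>j. norm (g k n j) * \<mu> k (Suc j)) \<le> lam k" if k: "k \<in> Kh" for k n
  proof -
    have pos: "\<mu> k l \<ge> 0" for l
      using \<mu>_pos[of k l] k by (simp add: Kh_def)
    have pos': "lam k \<ge> 0"
      using lam_pos[of k] k by (simp add: Kh_def)
    show ?thesis
    proof (cases "k \<in> Ks")
      case True
      from green_sum_bounds_stable[where P = P and r = "\<mu> k", OF True pos pos' s_\<mu>[OF True]] show ?thesis
        by (simp add: g_def)
    next
      case False
      with k have "k \<in> Ku"
        by (simp add: Kh_def)
      from green_sum_bounds_unstable[where P = P and r = "\<mu> k", OF False pos pos' u_\<mu>[OF this]] show ?thesis
        by (simp add: g_def)
    qed
  qed
  have f_norm: "norm (P k (Suc j) (f j x)) \<le> \<nu> k (Suc j)" if k: "k \<in> Kh" for k j x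
  proof -
    have "ennreal (norm (P k (Suc j) (f j x))) \<le> ennreal (\<nu> k (Suc j))"
      using f_bound[of k "Suc j"] k by (simp add: sup_norm_def SUP_le_iff Kh_def)
    moreover have "\<nu> k (Suc j) \<ge> 0"
      using \<nu>_pos[of k "Suc j"] k by (simp add: Kh_def)
    ultimately show ?thesis
      by simp
  qed
  \<comment> \<open>Finite summation over \<open>Kh\<close> makes the contraction factor the sum of
    all \<open>lam k\<close>, which is less than 1.\<close>
  interpret green_kernel A F q \<phi>
    "\<lambda>n j. \<Sum>k\<in>Kh. norm (g k n j) * \<nu> k (Suc j)" "\<lambda>n j. \<Sum>k\<in>Kh. norm (g k n j) * \<mu> k (Suc j)"
    "\<Sum>k\<in>Kh. C k" "\<Sum>k\<in>Kh. lam k"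
  proof
    show "self_homeomorphism (blinfun_apply (A n))" for n
      by (rule self_homeomorphism_blinfun[OF A_invertible])
    show "self_homeomorphism (F n)" for n
      by (rule F_homeo)
    show "continuous_on UNIV (\<phi> n j)" for n j
      unfolding \<phi>_def by (intro continuous_intros f_cont)
    show "norm (\<phi> n j x) \<le> (\<Sum>k\<in>Kh. norm (g k n j) * \<nu> k (Suc j))" for n j x
      unfolding \<phi>_def
      by (intro sum_norm_le order_trans[OF g_P] mult_left_mono f_norm) auto
    show "norm (\<phi> n j x - \<phi> n j y) \<le> (\<Sum>k\<in>Kh. norm (g k n j) * \<mu> k (Suc j)) * norm (x - y)"
      for n j x y
    proof -
      have "norm (g k n j (f j x) - g k n j (f j y))
          \<le> norm (g k n j) * \<mu> k (Suc j) * norm (x - y)" if k: "k \<in> Kh" for k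
      proof -
        have "norm (P k (Suc j) (f j x - f j y)) \<le> \<mu> k (Suc j) * norm (x - y)"
          using f_lipschitz[of k "Suc j" x y] k by (simp add: Kh_def blinfun.diff_right)
        then have "norm (g k n j) * norm (P k (Suc j) (f j x - f j y))
            \<le> norm (g k n j) * (\<mu> k (Suc j) * norm (x - y))"
          by (rule mult_left_mono) simp
        with g_P[OF k, of n j "f j x - f j y"] show ?thesis
          by (simp add: blinfun.diff_right mult.assoc)
      qed
      then show ?thesis
        unfolding \<phi>_def sum_subtractf[symmetric] sum_distrib_right by (rule sum_norm_le)
    qed
    show "\<phi> (Suc n) j x = A n (\<phi> n j x) + (if j = n then q n x else 0)" for n j x
      by (simp add: \<phi>_def q_def g_def green_Suc[of A n, OF A_invertible] plus_blinfun.rep_eq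
          blinfun.sum_right sum.distrib)
    show "summable (\<lambda>j. \<Sum>k\<in>Kh. norm (g k n j) * \<nu> k (Suc j))" for n
      by (intro summable_sum C)
    show "(\<Sum>j. \<Sum>k\<in>Kh. norm (g k n j) * \<nu> k (Suc j)) \<le> (\<Sum>k\<in>Kh. C k)" for n
      by (subst suminf_sum) (auto intro!: sum_mono C)
    show "(\<Sum>k\<in>Kh. norm (g k n j) * \<mu> k (Suc j)) \<ge> 0" for n j
      using \<mu>_pos by (intro sum_nonneg mult_nonneg_nonneg) (auto simp: Kh_def less_imp_le)
    show "summable (\<lambda>j. \<Sum>k\<in>Kh. norm (g k n j) * \<mu> k (Suc j))" for n
      using L by (intro summable_sum) blast
    show "(\<Sum>j. \<Sum>k\<in>Kh. norm (g k n j) * \<mu> k (Suc j)) \<le> (\<Sum>k\<in>Kh. lam k)" for n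
      using L by (subst suminf_sum) (auto intro!: sum_mono)
    show "(\<Sum>k\<in>Kh. lam k) < 1"
      using lam_sum by (simp add: Kh_def)
  qed
  \<comment> \<open>The central part of the perturbation; \<open>\<tau>\<close> will be its negative
    and \<open>\<tau>'\<close> the part itself.\<close>
  define \<sigma> where "\<sigma> n x = (\<Sum>k\<in>Kc. P k (n + 1) (f n x))" for n x
  have q_eq: "q n x = f n x - \<sigma> n x" for n x
    unfolding \<sigma>_def by (metis f_split add_diff_cancel_right' Suc_eq_plus1)
  have \<sigma>_cont: "continuous_on UNIV (\<sigma> n)" for n
    unfolding \<sigma>_def by (intro continuous_intros f_cont)
  have \<sigma>_range: "\<sigma> n x \<in> sum_of_ranges (\<lambda>k. P k (n + 1)) Kc" for n x
    unfolding sum_of_ranges_def \<sigma>_def by blast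
  \<comment> \<open>The sign is moved into the argument of each projection, so the summands stay in
    the ranges.\<close>
  have \<sigma>_range': "- \<sigma> n x \<in> sum_of_ranges (\<lambda>k. P k (n + 1)) Kc" for n x
    unfolding sum_of_ranges_def \<sigma>_def
    by (rule CollectI, rule exI[of _ "\<lambda>k. P k (n + 1) (- f n x)"])
      (auto simp flip: blinfun.minus_right sum_negf)
  \<comment> \<open>Either alternative kills the central part, which provides the assumption for the
    inverse maps. Projections at time \<open>n + 1\<close> act on \<open>f n\<close>.\<close>
  have F_eq: "F n x = A n x + q n x"
    if "Kc = {} \<or> (\<forall>k\<in>Kc. \<forall>n\<ge>1. \<forall>x. P k n (f (n - 1) x) = 0)" for n x
  proof -
    have "P k (n + 1) (f n x) = 0" if "k \<in> Kc" for k
      using that \<open>Kc = {} \<or> _\<close> by (auto dest!: bspec spec[of _ "n + 1"])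
    then have "\<sigma> n x = 0"
      by (simp add: \<sigma>_def)
    then show ?thesis
      by (simp add: F_def q_eq)
  qed
  have H_conj: "H (n + 1) (A n x) = A n (H n x) + f n (H n x) + - \<sigma> n (H n x)" for n x
    by (simp add: H_Suc q_eq)
  have H'_conj: "H' (n + 1) (A n x + f n x) = A n (H' n x) + \<sigma> n x" for n x
    using H'_Suc[of n x] by (simp add: F_def q_eq)
  show ?thesis
  proof (rule exI[of _ H], rule exI[of _ "\<lambda>n x. - \<sigma> n x"], rule exI[of _ H'], rule exI[of _ \<sigma>],
      intro conjI allI impI)
    show "(SUP n. sup_norm (\<lambda>x. H n x - x)) < \<infinity>" "(SUP n. sup_norm (\<lambda>x. H' n x - x)) < \<infinity>"
      by (rule SUP_sup_norm_finite, rule H_near_id H'_near_id)+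
    show "range (\<lambda>x. - \<sigma> n x) \<subseteq> sum_of_ranges (\<lambda>k. P k (n + 1)) Kc"
      "range (\<sigma> n) \<subseteq> sum_of_ranges (\<lambda>k. P k (n + 1)) Kc" for n
      using \<sigma>_range' \<sigma>_range by blast+
    show "continuous_on UNIV (\<lambda>x. - \<sigma> n x)" for n
      by (intro continuous_intros \<sigma>_cont)
    fix n
    assume "Kc = {} \<or> (\<forall>k\<in>Kc. \<forall>n\<ge>1. \<forall>x. P k n (f (n - 1) x) = 0)"
    note central = F_eq[OF this]
    show "self_homeomorphism (H n)" "self_homeomorphism (H' n)"
      using self_homeomorphism_H self_homeomorphism_H' central by blast+
    show "H n \<circ> H' n = id" "H' n \<circ> H n = id"
      using H_H' H'_H central by (auto simp: fun_eq_iff)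
    show "H (n + 1) \<circ> A n = (\<lambda>x. A n x + f n x) \<circ> H n"
      using H_Suc central[unfolded F_def] by (simp add: fun_eq_iff)
  qed (use H_cont H'_cont \<sigma>_cont H_conj H'_conj in \<open>auto simp: fun_eq_iff \<sigma>_def\<close>)
qed

end
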